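(* For all integers $n \geq 0$, $$b_{4,2}(n) \geq b_{3,2}(n),$$ where $b_{t,k}(n)$ denotes the total number of hooks of length $k$ in all the $t$-regular partitions of $n$.
   Context: A partition $\lambda$ of a positive integer $n$ is a finite sequence of positive integers $\lambda=(\lambda_1,\lambda_2,\ldots,\lambda_r)$ with $\lambda_1\geq\lambda_2\geq\cdots\geq\lambda_r$ and $\sum_{i=1}^r\lambda_i=n$; the $\lambda_i$ are its parts. For $n=0$ the only partition is the empty partition, which has no hooks. For an integer $t\geq 2$, a $t$-regular partition of $n$ is a partition of $n$ none of whose parts is divisible by $t$. The Young diagram of $(\lambda_1,\ldots,\lambda_r)$ is the left-justified array of boxes whose $i$-th row from the top contains $\lambda_i$ boxes. The hook length of a box in a Young diagram is the number of boxes directly to its right (in the same row), plus the number of boxes directly below it (in the same column), plus $1$ (for the box itself). A hook of length $k$ in a partition corresponds to a box of its Young diagram with hook length $k$. For integers $t\geq 2$ and $k\geq 1$, $b_{t,k}(n)$ denotes the number of hooks of length $k$ in all the $t$-regular partitions of $n$, that is, the sum over all $t$-regular partitions $\lambda$ of $n$ of the number of boxes in the Young diagram of $\lambda$ having hook length exactly $k$. *)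

theory Defs
  imports Main
begin

definition is_partition :: "nat \<Rightarrow> nat list \<Rightarrow> bool" where
  "is_partition n \<mu> \<longleftrightarrow>
     sorted_wrt (\<ge>) \<mu> \<and> (\<forall>p \<in> set \<mu>. p > 0) \<and> sum_list \<mu> = n"

definition regular_partitions :: "nat \<Rightarrow> nat \<Rightarrow> nat list set" where
  "regular_partitions t n = {\<mu>. is_partition n \<mu> \<and> (\<forall>p \<in> set \<mu>. \<not> t dvd p)}"

text \<open>Boxes are pairs (row, column), both counted from 0; row 0 is the top row.\<close>

definition young_diagram :: "nat list \<Rightarrow> (nat \<times> nat) set" where
  "young_diagram \<mu> = {(i, j). i < length \<mu> \<and> j < \<mu> ! i}"

definition hook_length :: "(nat \<times> nat) set \<Rightarrow> nat \<times> nat \<Rightarrow> nat" where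
  "hook_length D = (\<lambda>(i, j).
     card {j'. j' > j \<and> (i, j') \<in> D} + card {i'. i' > i \<and> (i', j) \<in> D} + 1)"

definition hooks_of_length :: "nat \<Rightarrow> nat list \<Rightarrow> (nat \<times> nat) set" where
  "hooks_of_length k \<mu> =
     {x \<in> young_diagram \<mu>. hook_length (young_diagram \<mu>) x = k}"

definition hook_count :: "nat \<Rightarrow> nat \<Rightarrow> nat \<Rightarrow> nat" where
  "hook_count t k n = (\<Sum>\<mu> \<in> regular_partitions t n. card (hooks_of_length k \<mu>))"

text \<open>All sets that are summed over or counted above are finite, so that no sum or
  cardinality takes its default value 0.\<close>

lemma finite_young_diagram: "finite (young_diagram \<mu>)"
proof -
  have "young_diagram \<mu> = (SIGMA i:{..<length \<mu>}. {..<\<mu> ! i})"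
    by (auto simp: young_diagram_def)
  then show ?thesis by simp
qed

lemma finite_arm: "finite {j'. j' > j \<and> (i, j') \<in> young_diagram \<mu>}"
  by (rule finite_subset[OF _ finite_imageI[OF finite_young_diagram, of snd \<mu>]]) force

lemma finite_leg: "finite {i'. i' > i \<and> (i', j) \<in> young_diagram \<mu>}"
  by (rule finite_subset[OF _ finite_imageI[OF finite_young_diagram, of fst \<mu>]]) force

lemma finite_hooks_of_length: "finite (hooks_of_length k \<mu>)"
  by (simp add: hooks_of_length_def finite_young_diagram)

lemma finite_regular_partitions: "finite (regular_partitions t n)"
proof (rule finite_subset)
  show "regular_partitions t n \<subseteq> {\<mu>. set \<mu> \<subseteq> {..n} \<and> length \<mu> \<le> n}"
  proof
    fix \<mu> assume "\<mu> \<in> regular_partitions t n"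
    then have pos: "\<forall>p \<in> set \<mu>. p > 0" and n: "sum_list \<mu> = n"
      by (auto simp: regular_partitions_def is_partition_def)
    have "length \<mu> \<le> sum_list \<mu>" using pos by (induction \<mu>) auto
    moreover have "set \<mu> \<subseteq> {..n}" using n member_le_sum_list by fastforce
    ultimately show "\<mu> \<in> {\<mu>. set \<mu> \<subseteq> {..n} \<and> length \<mu> \<le> n}" using n by simp
  qed
  show "finite {\<mu>. set \<mu> \<subseteq> {..n} \<and> length \<mu> \<le> n}"
    by (rule finite_lists_length_le) simp
qed

end

theory Submission
  imports Defs "HOL-Computational_Algebra.Formal_Power_Series" "HOL-Library.Multiset"
begin

unbundle fps_syntax

text \<open>
  A box has hook length 2 iff exactly one box lies to its right or below it. Such boxes correspond
  either to a part \<open>s \<ge> 2\<close> such that \<open>s - 1\<close> is not a part (arm 1, leg 0), or to a part that occurs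
  at least twice (arm 0, leg 1); this is \<open>card_2_hooks\<close>. Summing over all \<open>t\<close>-regular partitions
  and exchanging the sums gives \<open>\<Sum>n. b(t,2)(n) X^n = A(t) P(t)\<close>, where \<open>P(t)\<close> is the generating
  function of the \<open>t\<close>-regular partitions and \<open>A(t)\<close> is an explicit series with eventually periodic
  coefficients (\<open>hook_count_2_eq\<close>). The claim is that all coefficients of
    \<open>A(4) P(4) - A(3) P(3) = A(4) (P(4) - P(3)) + P(3) (A(4) - A(3))\<close>
  are nonnegative, and both summands on the right have this property.

  For the first one, Glaisher's identity \<open>P(t) = \<Prod>i. (1 + X^i + \<dots> + X^((t-1)i))\<close> shows
  that \<open>P(t)\<close> grows coefficientwise with \<open>t\<close>, and \<open>A(4)\<close> has nonnegative coefficients.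

  For the second one, \<open>A(4) - A(3)\<close> does have negative coefficients, but by \<open>two_hook_factor_diff\<close>
    \<open>(A(4) - A(3)) (1 - X^24) = (1 - X) (1 - X^2) U + (1 - X) V + W\<close>
  with polynomials \<open>U\<close>, \<open>V\<close>, \<open>W\<close> that have nonnegative coefficients. The products
  \<open>P(3) (1 - X)\<close> and \<open>P(3) (1 - X) (1 - X^2)\<close> count the 3-regular partitions without the part 1,
  and without the parts 1 and 2, so they have nonnegative coefficients. Finally, dividing
  by \<open>1 - X^24\<close> preserves nonnegativity.
\<close>

section \<open>Hooks of length 2\<close>

lemma young_diagram_Cons [simp]:
  "(0, j) \<in> young_diagram (x # \<mu>) \<longleftrightarrow> j < x"
  "(Suc i, j) \<in> young_diagram (x # \<mu>) \<longleftrightarrow> (i, j) \<in> young_diagram \<mu>"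
  by (simp_all add: young_diagram_def)

lemma hook_length_Cons_Suc:
  "hook_length (young_diagram (x # \<mu>)) (Suc i, j) = hook_length (young_diagram \<mu>) (i, j)"
proof -
  have "{i'. i' > Suc i \<and> (i', j) \<in> young_diagram (x # \<mu>)} =
        Suc ` {i'. i' > i \<and> (i', j) \<in> young_diagram \<mu>}"
  proof (intro set_eqI iffI)
    fix k assume "k \<in> {i'. i' > Suc i \<and> (i', j) \<in> young_diagram (x # \<mu>)}"
    then show "k \<in> Suc ` {i'. i' > i \<and> (i', j) \<in> young_diagram \<mu>}"
      by (cases k) (auto simp: young_diagram_def)
  qed (auto simp: young_diagram_def)
  moreover have "{j'. j' > j \<and> (Suc i, j') \<in> young_diagram (x # \<mu>)} =
        {j'. j' > j \<and> (i, j') \<in> young_diagram \<mu>}"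
    by (auto simp: young_diagram_def)
  ultimately show ?thesis
    by (simp add: hook_length_def card_image)
qed

lemma hook_length_Cons_0:
  assumes "j < x"
  shows "hook_length (young_diagram (x # \<mu>)) (0, j) =
           (x - Suc j) + card {i. i < length \<mu> \<and> j < \<mu> ! i} + 1"
proof -
  have "{i'. i' > 0 \<and> (i', j) \<in> young_diagram (x # \<mu>)} =
        Suc ` {i. i < length \<mu> \<and> j < \<mu> ! i}"
  proof (intro set_eqI iffI)
    fix k assume "k \<in> {i'. i' > 0 \<and> (i', j) \<in> young_diagram (x # \<mu>)}"
    then show "k \<in> Suc ` {i. i < length \<mu> \<and> j < \<mu> ! i}"
      by (cases k) (auto simp: young_diagram_def)
  qed (auto simp: young_diagram_def)
  moreover have "{j'. j' > j \<and> (0, j') \<in> young_diagram (x # \<mu>)} = {Suc j..<x}"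
    by (auto simp: young_diagram_def)
  ultimately show ?thesis
    by (simp add: hook_length_def card_image)
qed

text \<open>
  Putting a new row on top of a diagram does not change the hooks of the old boxes, so hooks can
  be counted row by row.
\<close>

lemma card_hooks_of_length_Cons:
  "card (hooks_of_length k (x # \<mu>)) =
     card {j. j < x \<and> (x - Suc j) + card {i. i < length \<mu> \<and> j < \<mu> ! i} + 1 = k} +
     card (hooks_of_length k \<mu>)"
proof -
  let ?J = "{j. j < x \<and> (x - Suc j) + card {i. i < length \<mu> \<and> j < \<mu> ! i} + 1 = k}"
  let ?s = "\<lambda>(i, j). (Suc i, j)"
  have "hooks_of_length k (x # \<mu>) = Pair 0 ` ?J \<union> ?s ` hooks_of_length k \<mu>"
  proof (intro set_eqI iffI)
    fix b assume b: "b \<in> hooks_of_length k (x # \<mu>)"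
    obtain i j where ij: "b = (i, j)" by (cases b)
    show "b \<in> Pair 0 ` ?J \<union> ?s ` hooks_of_length k \<mu>"
    proof (cases i)
      case 0
      then have "j < x" using b ij by (simp add: hooks_of_length_def)
      then have "j \<in> ?J"
        using b ij 0 by (simp add: hooks_of_length_def hook_length_Cons_0)
      then show ?thesis using ij 0 by blast
    next
      case (Suc i')
      then have "(i', j) \<in> hooks_of_length k \<mu>"
        using b ij by (simp add: hooks_of_length_def hook_length_Cons_Suc)
      then show ?thesis using ij Suc by force
    qed
  next
    fix b assume "b \<in> Pair 0 ` ?J \<union> ?s ` hooks_of_length k \<mu>"
    then show "b \<in> hooks_of_length k (x # \<mu>)"
      by (auto simp: hooks_of_length_def hook_length_Cons_0 hook_length_Cons_Suc)
  qed
  moreover have "finite ?J" by simp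
  moreover have "finite (?s ` hooks_of_length k \<mu>)" by (simp add: finite_hooks_of_length)
  moreover have "Pair 0 ` ?J \<inter> ?s ` hooks_of_length k \<mu> = {}" by auto
  moreover have "card (?s ` hooks_of_length k \<mu>) = card (hooks_of_length k \<mu>)"
    by (rule card_image) (auto simp: inj_on_def)
  moreover have "card (Pair 0 ` ?J :: (nat \<times> nat) set) = card ?J"
    by (rule card_image) (auto simp: inj_on_def)
  ultimately show ?thesis by (simp add: card_Un_disjoint)
qed

text \<open>
  The parts \<open>s \<ge> 2\<close> with \<open>s - 1\<close> not a part. The bound excludes \<open>s = 1\<close>: a row of length 1 contains
  no box with arm 1.
\<close>

definition gap_parts :: "nat multiset \<Rightarrow> nat set" where
  "gap_parts M = {s \<in> set_mset M. 2 \<le> s \<and> s - 1 \<notin> set_mset M}"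

text \<open>The parts that occur at least twice.\<close>

definition repeated_parts :: "nat multiset \<Rightarrow> nat set" where
  "repeated_parts M = {s. 2 \<le> count M s}"

lemma finite_gap_parts: "finite (gap_parts M)"
  by (simp add: gap_parts_def)

lemma finite_repeated_parts: "finite (repeated_parts M)"
  by (rule finite_subset[of _ "set_mset M"])
     (auto simp: repeated_parts_def simp flip: count_greater_zero_iff)

text \<open>
  Induction over the rows from the bottom to the top: a new largest part \<open>x\<close> brings a hook of
  length 2 with leg 1 iff \<open>x\<close> occurs exactly once below, and one with arm 1 iff neither \<open>x\<close> nor
  \<open>x - 1\<close> occurs below.
\<close>

lemma card_2_hooks:
  assumes "sorted_wrt (\<ge>) \<mu>" and "\<forall>p\<in>set \<mu>. p > 0"
  shows "card (hooks_of_length 2 \<mu>) =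
           card (gap_parts (mset \<mu>)) + card (repeated_parts (mset \<mu>))"
  using assms
proof (induction \<mu>)
  case Nil
  then show ?case
    by (simp add: hooks_of_length_def young_diagram_def gap_parts_def repeated_parts_def)
next
  case (Cons x \<mu>)
  have le: "y \<le> x" if "y \<in> set \<mu>" for y using Cons.prems that by auto
  have pos: "x > 0" using Cons.prems by simp
  let ?g = "\<lambda>j. card {i. i < length \<mu> \<and> j < \<mu> ! i}"
  let ?J = "{j. j < x \<and> (x - Suc j) + ?g j + 1 = 2}"
  let ?M = "mset \<mu>"
  have g1: "?g (x - 1) = count ?M x"
  proof -
    have "{i. i < length \<mu> \<and> x - 1 < \<mu> ! i} = {i. i < length \<mu> \<and> x = \<mu> ! i}"
      using le pos by (force dest: nth_mem)
    then show ?thesis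
      by (simp add: count_mset count_list_eq_length_filter length_filter_conv_card)
  qed
  have g2: "?g (x - 2) = 0 \<longleftrightarrow> x \<notin> set \<mu> \<and> x - 1 \<notin> set \<mu>" if "2 \<le> x"
  proof -
    have "?g (x - 2) = 0 \<longleftrightarrow> (\<forall>y\<in>set \<mu>. \<not> x - 2 < y)"
      by (simp add: all_set_conv_all_nth Collect_empty_eq)
    also have "\<dots> \<longleftrightarrow> (\<forall>y\<in>set \<mu>. y \<noteq> x \<and> y \<noteq> x - 1)"
      using le that by (force simp: not_less)
    finally show ?thesis by auto
  qed
  have "?J = {j. j = x - 1 \<and> ?g (x - 1) = 1} \<union> {j. 2 \<le> x \<and> j = x - 2 \<and> ?g (x - 2) = 0}"
    (is "_ = ?A \<union> ?B")
  proof (intro set_eqI iffI)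
    fix j assume "j \<in> ?J"
    then have j: "j < x" "(x - Suc j) + ?g j + 1 = 2" by auto
    then consider "x - Suc j = 0" "?g j = 1" | "x - Suc j = 1" "?g j = 0" by linarith
    then show "j \<in> ?A \<union> ?B"
    proof cases
      case 1
      then have "j = x - 1" using j by simp
      then show ?thesis using 1 by simp
    next
      case 2
      then have "j = x - 2" "2 \<le> x" using j by linarith+
      then show ?thesis using 2 by simp
    qed
  next
    fix j assume "j \<in> ?A \<union> ?B"
    then show "j \<in> ?J" using pos by auto
  qed
  moreover have "card (?A \<union> ?B) = card ?A + card ?B"
    by (rule card_Un_disjoint) (use pos in auto)
  moreover have "card ?A = of_bool (count ?M x = 1)"
    unfolding g1 by (cases "count ?M x = 1") auto
  moreover have "card ?B = of_bool (2 \<le> x \<and> x \<notin> set \<mu> \<and> x - 1 \<notin> set \<mu>)"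
    using g2 by (cases "2 \<le> x") auto
  ultimately have row: "card ?J = of_bool (count ?M x = 1) +
      of_bool (2 \<le> x \<and> x \<notin> set \<mu> \<and> x - 1 \<notin> set \<mu>)" by simp
  have rep: "card (repeated_parts (add_mset x ?M)) =
      card (repeated_parts ?M) + of_bool (count ?M x = 1)"
  proof (cases "count ?M x = 1")
    case True
    then have "x \<in># ?M" by (intro count_inI) simp
    with True have "repeated_parts (add_mset x ?M) = insert x (repeated_parts ?M)"
      by (auto simp: repeated_parts_def)
    moreover have "x \<notin> repeated_parts ?M" using True by (simp add: repeated_parts_def)
    ultimately show ?thesis using True by (simp add: finite_repeated_parts)
  next
    case False
    have "2 \<le> count (add_mset x ?M) s \<longleftrightarrow> 2 \<le> count ?M s" for s
    proof (cases "s = x")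
      case True
      then have "count (add_mset x ?M) s = count ?M s + 1" "count ?M s \<noteq> 1"
        using False by simp_all
      then show ?thesis by (intro iffI) linarith+
    qed simp
    then have "repeated_parts (add_mset x ?M) = repeated_parts ?M"
      unfolding repeated_parts_def by blast
    then show ?thesis using False by simp
  qed
  have gap: "card (gap_parts (add_mset x ?M)) =
      card (gap_parts ?M) + of_bool (2 \<le> x \<and> x \<notin> set \<mu> \<and> x - 1 \<notin> set \<mu>)"
  proof -
    \<comment> \<open>As \<open>x\<close> is maximal, it does not fill the gap below another part.\<close>
    have *: "s - 1 \<noteq> x" if "s \<in> set \<mu>" for s using le[OF that] pos by linarith
    show ?thesis
    proof (cases "2 \<le> x \<and> x \<notin> set \<mu> \<and> x - 1 \<notin> set \<mu>")
      case True
      then have "gap_parts (add_mset x ?M) = insert x (gap_parts ?M)"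
        using * by (auto simp: gap_parts_def)
      moreover have "x \<notin> gap_parts ?M" using True by (simp add: gap_parts_def)
      ultimately show ?thesis using True by (simp add: finite_gap_parts)
    next
      case False
      then have "gap_parts (add_mset x ?M) = gap_parts ?M"
        using * by (auto simp: gap_parts_def)
      then show ?thesis using False by simp
    qed
  qed
  show ?case
    unfolding card_hooks_of_length_Cons[of 2 x \<mu>] using Cons row rep gap by simp
qed

section \<open>Generating functions of partitions into parts from a set\<close>

text \<open>
  Partitions of \<open>n\<close> with all parts in \<open>S\<close>, as multisets. They are of interest for \<open>0 \<notin> S\<close> only, since
  otherwise there are infinitely many for each \<open>n\<close> for which there is one.
\<close>

definition partitions_in :: "nat set \<Rightarrow> nat \<Rightarrow> nat multiset set" where
  "partitions_in S n = {M. set_mset M \<subseteq> S \<and> sum_mset M = n}"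

text \<open>
  The generating function of the number of partitions with parts in \<open>S\<close>. Integer coefficients
  allow for subtraction.
\<close>

definition partitions_gf :: "nat set \<Rightarrow> int fps" where
  "partitions_gf S = Abs_fps (\<lambda>n. int (card (partitions_in S n)))"

lemma bij_betw_mset_regular_partitions:
  "bij_betw mset (regular_partitions t n) (partitions_in {s. \<not> t dvd s} n)"
  unfolding bij_betw_def
proof
  show "inj_on mset (regular_partitions t n)"
  proof (rule inj_onI)
    fix \<mu> \<nu> assume *: "\<mu> \<in> regular_partitions t n" "\<nu> \<in> regular_partitions t n" "mset \<mu> = mset \<nu>"
    then have "sorted (rev \<mu>)" "sorted (rev \<nu>)" "mset (rev \<mu>) = mset (rev \<nu>)"
      by (simp_all add: regular_partitions_def is_partition_def sorted_wrt_rev)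
    then have "rev \<mu> = rev \<nu>" by (metis properties_for_sort)
    then show "\<mu> = \<nu>" by simp
  qed
  show "mset ` regular_partitions t n = partitions_in {s. \<not> t dvd s} n"
  proof (intro set_eqI iffI)
    fix M assume "M \<in> partitions_in {s. \<not> t dvd s} n"
    then have M: "set_mset M \<subseteq> {s. \<not> t dvd s}" "sum_mset M = n"
      by (auto simp: partitions_in_def)
    let ?\<mu> = "rev (sorted_list_of_multiset M)"
    have "p > 0" if "p \<in># M" for p using that M by (cases p) auto
    then have "?\<mu> \<in> regular_partitions t n"
      using M by (auto simp: regular_partitions_def is_partition_def sorted_wrt_rev
          simp flip: sum_mset_sum_list)
    moreover have "mset ?\<mu> = M" by simp
    ultimately show "M \<in> mset ` regular_partitions t n" by force
  qed (auto simp: partitions_in_def regular_partitions_def is_partition_def sum_mset_sum_list)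
qed

lemma finite_partitions_in:
  assumes "0 \<notin> S"
  shows "finite (partitions_in S n)"
proof (rule finite_subset)
  \<comment> \<open>Only 0 is divisible by 0, so 0-regular partitions are arbitrary partitions.\<close>
  show "partitions_in S n \<subseteq> mset ` regular_partitions 0 n"
    using assms bij_betw_mset_regular_partitions[of 0 n]
    by (auto simp: partitions_in_def bij_betw_def)
qed (simp add: finite_regular_partitions)

lemma card_partitions_in_containing:
  assumes "set_mset K \<subseteq> S"
  shows "int (card {M \<in> partitions_in S n. K \<subseteq># M}) =
           (fps_X ^ sum_mset K * partitions_gf S) $ n"
proof (cases "sum_mset K \<le> n")
  case True
  have "bij_betw (\<lambda>M. K + M) (partitions_in S (n - sum_mset K)) {M \<in> partitions_in S n. K \<subseteq># M}"
    by (rule bij_betw_byWitness[where f' = "\<lambda>M. M - K"])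
       (use assms True in \<open>auto simp: partitions_in_def subset_mset.le_iff_add\<close>)
  then have "card (partitions_in S (n - sum_mset K)) = card {M \<in> partitions_in S n. K \<subseteq># M}"
    by (rule bij_betw_same_card)
  then show ?thesis
    using True by (simp add: fps_X_power_mult_nth partitions_gf_def)
next
  case False
  then have "{M \<in> partitions_in S n. K \<subseteq># M} = {}"
    by (auto simp: partitions_in_def subset_mset.le_iff_add)
  then have "card {M \<in> partitions_in S n. K \<subseteq># M} = 0" by (simp only: card.empty)
  then show ?thesis using False by (simp add: fps_X_power_mult_nth)
qed

text \<open>Multiplication by \<open>1 - X^s\<close> cancels the partitions that contain \<open>s\<close>.\<close>

lemma partitions_gf_remove:
  assumes "0 \<notin> S" "s \<in> S"
  shows "(1 - fps_X ^ s) * partitions_gf S = partitions_gf (S - {s})"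
proof (rule fps_ext)
  fix n
  let ?A = "{M \<in> partitions_in S n. {#s#} \<subseteq># M}"
  have "partitions_in S n = ?A \<union> partitions_in (S - {s}) n"
    by (auto simp: partitions_in_def)
  moreover have "?A \<inter> partitions_in (S - {s}) n = {}"
    by (auto simp: partitions_in_def)
  moreover have "finite ?A" "finite (partitions_in (S - {s}) n)"
    using assms by (simp_all add: finite_partitions_in)
  ultimately have "card (partitions_in S n) = card ?A + card (partitions_in (S - {s}) n)"
    by (metis card_Un_disjoint)
  moreover have "int (card ?A) = (fps_X ^ s * partitions_gf S) $ n"
    using card_partitions_in_containing[of "{#s#}" S n] assms by simp
  ultimately show "((1 - fps_X ^ s) * partitions_gf S) $ n = partitions_gf (S - {s}) $ n"
    by (simp add: left_diff_distrib) (simp add: partitions_gf_def)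
qed

lemma partitions_gf_remove_finite:
  assumes "finite A" "A \<subseteq> S" "0 \<notin> S"
  shows "(\<Prod>i\<in>A. 1 - fps_X ^ i) * partitions_gf S = partitions_gf (S - A)"
  using assms
proof (induction A)
  case (insert a A)
  have "(\<Prod>i\<in>insert a A. 1 - fps_X ^ i) * partitions_gf S =
        (1 - fps_X ^ a) * partitions_gf (S - A)"
    using insert by (simp add: mult.assoc)
  also have "\<dots> = partitions_gf (S - A - {a})"
    by (rule partitions_gf_remove) (use insert in auto)
  also have "S - A - {a} = S - insert a A" by auto
  finally show ?case .
qed simp

section \<open>Glaisher's identity\<close>

text \<open>
  Congruence modulo \<open>X^(N+1)\<close>. It replaces the infinite products of the classical
  generating functions by finite ones.
\<close>

definition fps_agree :: "nat \<Rightarrow> 'a fps \<Rightarrow> 'a fps \<Rightarrow> bool" where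
  "fps_agree N F G \<longleftrightarrow> (\<forall>m\<le>N. F $ m = G $ m)"

lemma fps_agree_mult:
  fixes F G :: "'a::semiring_0 fps"
  assumes "fps_agree N F F'" "fps_agree N G G'"
  shows "fps_agree N (F * G) (F' * G')"
  using assms unfolding fps_agree_def fps_mult_nth by (auto intro!: sum.cong)

lemma fps_agree_prod_1:
  fixes F :: "'b \<Rightarrow> 'a::comm_semiring_1 fps"
  assumes "\<And>i. i \<in> A \<Longrightarrow> fps_agree N (F i) 1"
  shows "fps_agree N (\<Prod>i\<in>A. F i) 1"
  using assms
proof (induction A rule: infinite_finite_induct)
  case (insert a A)
  then have "fps_agree N (F a * (\<Prod>i\<in>A. F i)) (1 * 1)" by (intro fps_agree_mult) auto
  then show ?case using insert by simp
qed (auto simp: fps_agree_def)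

lemma partitions_gf_agree_1:
  assumes "0 \<notin> S" "S \<inter> {..N} = {}"
  shows "fps_agree N (partitions_gf S) 1"
  unfolding fps_agree_def
proof (intro allI impI)
  fix m assume m: "m \<le> N"
  have "M = {#}" if "M \<in> partitions_in S m" for M
  proof (rule ccontr)
    assume "M \<noteq> {#}"
    then obtain s where s: "s \<in># M" by blast
    then have "s \<le> sum_mset M" by (metis le_add1 multi_member_split sum_mset.add_mset)
    then have "s \<in> S \<inter> {..N}" using s that m by (auto simp: partitions_in_def)
    then show False using assms by simp
  qed
  then have "partitions_in S m \<subseteq> {{#}}" by blast
  moreover have "{#} \<in> partitions_in S m \<longleftrightarrow> m = 0" by (auto simp: partitions_in_def)
  ultimately have "partitions_in S m = (if m = 0 then {{#}} else {})" by auto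
  then show "partitions_gf S $ m = 1 $ m"
    by (simp add: partitions_gf_def)
qed

text \<open>
  Glaisher's identity: there are as many \<open>t\<close>-regular partitions as partitions in which each part
  occurs fewer than \<open>t\<close> times.
\<close>

lemma glaisher_agree:
  assumes "t > 0"
  shows "fps_agree N (partitions_gf {s. \<not> t dvd s})
           (\<Prod>i\<in>{1..N}. \<Sum>j<t. (fps_X ^ i) ^ j)"
proof -
  let ?P = "partitions_gf {s. \<not> t dvd s}"
  let ?q = "\<lambda>A. \<Prod>i\<in>A. (1 - fps_X ^ i) :: int fps"
  let ?E = "(\<Prod>i\<in>{1..N}. \<Sum>j<t. (fps_X ^ i) ^ j) :: int fps"
  let ?D = "{i \<in> {1..N}. \<not> t dvd i}"
  let ?D' = "{i \<in> {1..N}. t dvd i}"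
  let ?T = "(*) t ` {1..N}"
  have "?E * ?q {1..N} = (\<Prod>i\<in>{1..N}. 1 - (fps_X ^ i) ^ t)"
    by (simp add: one_diff_power_eq mult.commute flip: prod.distrib)
  also have "\<dots> = ?q ?T"
    using assms by (subst prod.reindex) (auto simp: inj_on_def mult.commute simp flip: power_mult)
  also have "\<dots> = ?q ?D' * ?q (?T - ?D')"
  proof -
    have "?D' \<subseteq> ?T"
    proof
      fix i assume "i \<in> ?D'"
      then obtain k where "i = t * k" "1 \<le> t * k" "t * k \<le> N" by auto
      moreover from this have "k \<noteq> 0" by (intro notI) simp
      moreover have "k \<le> N"
        using assms calculation by (metis le_trans mult_le_mono1 nat_mult_1 Suc_leI One_nat_def)
      ultimately show "i \<in> ?T" by (intro image_eqI[of _ _ k]) auto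
    qed
    then show ?thesis by (subst prod.subset_diff[of ?D']) (auto simp: mult.commute)
  qed
  also have "?q {1..N} = ?q ?D' * ?q ?D"
  proof -
    have "{1..N} = ?D' \<union> ?D" by auto
    then show ?thesis
      by (metis (no_types, lifting) prod.union_disjoint finite_Un finite_atLeastAtMost
          disjoint_iff mem_Collect_eq)
  qed
  finally have eq: "?q ?D' * (?E * ?q ?D) = ?q ?D' * ?q (?T - ?D')"
    by (simp add: mult_ac)
  have nz: "?q ?D' \<noteq> 0"
  proof -
    have "(1 - fps_X ^ i :: int fps) \<noteq> 0" if "i \<in> ?D'" for i
    proof
      assume "(1 - fps_X ^ i :: int fps) = 0"
      then have "(1 - fps_X ^ i :: int fps) $ 0 = 0" by simp
      then show False using that by simp
    qed
    then show ?thesis by simp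
  qed
  have ED: "?E * ?q ?D = ?q (?T - ?D')"
    by (rule mult_left_cancel[OF nz, THEN iffD1, OF eq])
  \<comment> \<open>The remaining exponents are multiples of \<open>t\<close> that exceed \<open>N\<close>.\<close>
  have "fps_agree N (?q (?T - ?D')) 1"
    by (rule fps_agree_prod_1) (use assms in \<open>auto simp: fps_agree_def\<close>)
  then have "fps_agree N (?P * (?E * ?q ?D)) (?P * 1)"
    unfolding ED by (intro fps_agree_mult) (auto simp: fps_agree_def)
  moreover have "fps_agree N (?E * (?q ?D * ?P)) (?E * 1)"
  proof (rule fps_agree_mult)
    have "?q ?D * ?P = partitions_gf ({s. \<not> t dvd s} - ?D)"
      by (rule partitions_gf_remove_finite) auto
    also have "fps_agree N \<dots> 1"
      by (rule partitions_gf_agree_1) (auto simp: Suc_le_eq intro!: Nat.gr0I)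
    finally show "fps_agree N (?q ?D * ?P) 1" .
  qed (simp add: fps_agree_def)
  ultimately show ?thesis by (simp add: fps_agree_def mult_ac)
qed

section \<open>Series with nonnegative coefficients\<close>

text \<open>All coefficients are nonnegative.\<close>

definition fps_nonneg :: "int fps \<Rightarrow> bool" where
  "fps_nonneg F \<longleftrightarrow> (\<forall>n. 0 \<le> F $ n)"

lemma fps_nonneg_add: "fps_nonneg F \<Longrightarrow> fps_nonneg G \<Longrightarrow> fps_nonneg (F + G)"
  by (simp add: fps_nonneg_def)

lemma fps_nonneg_mult: "fps_nonneg F \<Longrightarrow> fps_nonneg G \<Longrightarrow> fps_nonneg (F * G)"
  by (simp add: fps_nonneg_def fps_mult_nth sum_nonneg)

lemma fps_nonneg_X_power: "fps_nonneg (fps_X ^ k)"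
  by (simp add: fps_nonneg_def)

lemma fps_nonneg_numeral: "fps_nonneg (numeral k)"
  by (simp add: fps_nonneg_def fps_numeral_nth)

lemma fps_nonneg_sum: "(\<And>i. i \<in> A \<Longrightarrow> fps_nonneg (F i)) \<Longrightarrow> fps_nonneg (\<Sum>i\<in>A. F i)"
  by (simp add: fps_nonneg_def fps_sum_nth sum_nonneg)

lemma fps_nonneg_partitions_gf: "fps_nonneg (partitions_gf S)"
  by (simp add: fps_nonneg_def partitions_gf_def)

lemmas fps_nonneg_intros = fps_nonneg_add fps_nonneg_mult fps_nonneg_X_power fps_nonneg_numeral
  fps_nonneg_partitions_gf

lemma fps_nonneg_prod_diff:
  assumes "\<And>i. i \<in> A \<Longrightarrow> fps_nonneg (F i)" "\<And>i. i \<in> A \<Longrightarrow> fps_nonneg (G i - F i)"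
  shows "fps_nonneg (\<Prod>i\<in>A. F i) \<and> fps_nonneg ((\<Prod>i\<in>A. G i) - (\<Prod>i\<in>A. F i))"
  using assms
proof (induction A rule: infinite_finite_induct)
  case (insert a A)
  let ?F = "\<Prod>i\<in>A. F i" and ?G = "\<Prod>i\<in>A. G i"
  have IH: "fps_nonneg ?F" "fps_nonneg (?G - ?F)" using insert by auto
  have a: "fps_nonneg (F a)" "fps_nonneg (G a - F a)" using insert by auto
  have "fps_nonneg ((G a - F a) * (?G - ?F) + (G a - F a) * ?F + F a * (?G - ?F))"
    by (intro fps_nonneg_intros IH a)
  also have "(G a - F a) * (?G - ?F) + (G a - F a) * ?F + F a * (?G - ?F) = G a * ?G - F a * ?F"
    by (simp add: algebra_simps)
  finally show ?case using insert.hyps IH a by (simp add: fps_nonneg_mult)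
qed (auto simp: fps_nonneg_def)

text \<open>\<open>t\<close>-regular partitions become more frequent when \<open>t\<close> grows.\<close>

lemma fps_nonneg_partitions_gf_diff:
  assumes "0 < t" "t \<le> u"
  shows "fps_nonneg (partitions_gf {s. \<not> u dvd s} - partitions_gf {s. \<not> t dvd s})"
  unfolding fps_nonneg_def
proof
  fix n
  let ?F = "\<lambda>t i. (\<Sum>j<t. (fps_X ^ i) ^ j) :: int fps"
  have "fps_nonneg (?F u i - ?F t i)" for i
  proof -
    have "?F u i - ?F t i = (\<Sum>j\<in>{..<u} - {..<t}. (fps_X ^ i) ^ j)"
      using assms by (subst sum_diff) auto
    then show ?thesis by (simp add: fps_nonneg_sum fps_nonneg_X_power flip: power_mult)
  qed
  then have "fps_nonneg ((\<Prod>i\<in>{1..n}. ?F u i) - (\<Prod>i\<in>{1..n}. ?F t i))"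
    by (intro fps_nonneg_prod_diff[THEN conjunct2])
       (simp_all add: fps_nonneg_sum fps_nonneg_X_power flip: power_mult)
  then have "0 \<le> (\<Prod>i\<in>{1..n}. ?F u i) $ n - (\<Prod>i\<in>{1..n}. ?F t i) $ n"
    by (simp add: fps_nonneg_def)
  moreover have "partitions_gf {s. \<not> t dvd s} $ n = (\<Prod>i\<in>{1..n}. ?F t i) $ n"
    using glaisher_agree[of t n] assms by (simp add: fps_agree_def)
  moreover have "partitions_gf {s. \<not> u dvd s} $ n = (\<Prod>i\<in>{1..n}. ?F u i) $ n"
    using glaisher_agree[of u n] assms by (simp add: fps_agree_def)
  ultimately show "0 \<le> (partitions_gf {s. \<not> u dvd s} - partitions_gf {s. \<not> t dvd s}) $ n"
    by simp
qed

text \<open>Division by \<open>1 - X^k\<close> preserves nonnegativity, as the inverse is \<open>1 + X^k + X^(2k) + \<dots>\<close>.\<close>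

lemma fps_nonneg_cancel:
  assumes "k > 0" "fps_nonneg (F * (1 - fps_X ^ k))"
  shows "fps_nonneg F"
  unfolding fps_nonneg_def
proof
  fix n show "0 \<le> F $ n"
  proof (induction n rule: less_induct)
    case (less n)
    have "0 \<le> (F * (1 - fps_X ^ k)) $ n" using assms by (simp add: fps_nonneg_def)
    also have "\<dots> = F $ n - (if n < k then 0 else F $ (n - k))"
      by (simp add: right_diff_distrib fps_X_power_mult_right_nth)
    finally show ?case using less[of "n - k"] assms by (auto split: if_splits)
  qed
qed

section \<open>The generating function of the hooks of length 2\<close>

text \<open>
  The series
    \<open>\<Sum>s. X^(2s) + \<Sum>s \<ge> 2. X^s - \<Sum>s. X^(2s-1)\<close>,
  where \<open>s\<close> runs over the numbers not divisible by \<open>t\<close>, and in the last sum \<open>s - 1\<close> is not divisible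
  by \<open>t\<close> either. The exponents are the sizes of the sub-multisets that force \<open>s\<close> to
  be repeated, force \<open>s\<close> to be a part, and force both \<open>s\<close> and \<open>s - 1\<close> to be parts. The last sum has
  no term for \<open>s = 1\<close>, since \<open>t\<close> divides 0.
\<close>

definition two_hook_factor :: "nat \<Rightarrow> int fps" where
  "two_hook_factor t = Abs_fps (\<lambda>m.
     of_bool (even m \<and> \<not> t dvd m div 2) + of_bool (2 \<le> m \<and> \<not> t dvd m)
     - of_bool (odd m \<and> \<not> t dvd m div 2 \<and> \<not> t dvd m div 2 + 1))"

lemma hook_count_2_eq:
  "int (hook_count t 2 n) = (two_hook_factor t * partitions_gf {s. \<not> t dvd s}) $ n"
proof -
  let ?S = "{s. \<not> t dvd s}"
  let ?P = "partitions_in ?S n"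
  let ?G = "partitions_gf ?S"
  let ?I = "{s \<in> {1..n}. \<not> t dvd s}"
  have fin: "finite ?P" by (rule finite_partitions_in) simp
  have I: "s \<in> ?I" if "M \<in> ?P" "s \<in># M" for M s
  proof -
    have "s \<le> sum_mset M" using that(2) by (metis le_add1 multi_member_split sum_mset.add_mset)
    moreover have "\<not> t dvd s" using that by (auto simp: partitions_in_def)
    moreover from this have "s \<noteq> 0" by (intro notI) simp
    ultimately show ?thesis using that by (auto simp: partitions_in_def)
  qed
  have containing: "(\<Sum>M\<in>?P. of_bool (K \<subseteq># M)) = (fps_X ^ sum_mset K * ?G) $ n"
    if "set_mset K \<subseteq> ?S" for K
  proof -
    have "(\<Sum>M\<in>?P. of_bool (K \<subseteq># M) :: int) = int (card {M \<in> ?P. K \<subseteq># M})"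
      using fin by (simp add: sum_of_bool_eq Int_def)
    then show ?thesis using card_partitions_in_containing[OF that, of n] by simp
  qed
  have rep: "(\<Sum>M\<in>?P. int (card (repeated_parts M))) = (\<Sum>s\<in>?I. (fps_X ^ (2 * s) * ?G) $ n)"
  proof -
    have "int (card (repeated_parts M)) = (\<Sum>s\<in>?I. of_bool ({#s, s#} \<subseteq># M))" if "M \<in> ?P" for M
    proof -
      have "repeated_parts M = {s \<in> ?I. {#s, s#} \<subseteq># M}"
        using I[OF that] by (auto simp: repeated_parts_def insert_subset_eq_iff
            simp flip: count_greater_zero_iff)
      then show ?thesis by (simp add: sum_of_bool_eq Int_def)
    qed
    then have "(\<Sum>M\<in>?P. int (card (repeated_parts M))) =
        (\<Sum>s\<in>?I. \<Sum>M\<in>?P. of_bool ({#s, s#} \<subseteq># M))"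
      by (subst sum.swap) (rule sum.cong[OF refl])
    also have "\<dots> = (\<Sum>s\<in>?I. (fps_X ^ (2 * s) * ?G) $ n)"
      by (intro sum.cong refl, subst containing) (auto simp: mult_2)
    finally show ?thesis .
  qed
  have gap: "(\<Sum>M\<in>?P. int (card (gap_parts M))) =
      (\<Sum>s\<in>?I. of_bool (2 \<le> s) * (fps_X ^ s * ?G) $ n
              - of_bool (\<not> t dvd s - 1) * (fps_X ^ (2 * s - 1) * ?G) $ n)"
  proof -
    have "int (card (gap_parts M)) = (\<Sum>s\<in>?I. of_bool (2 \<le> s) * of_bool ({#s#} \<subseteq># M)
        - of_bool (\<not> t dvd s - 1) * of_bool ({#s, s - 1#} \<subseteq># M))" if M: "M \<in> ?P" for M
    proof -
      have "gap_parts M = {s \<in> ?I. s \<in> gap_parts M}"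
        using I[OF M] by (auto simp: gap_parts_def)
      then have "int (card (gap_parts M)) = (\<Sum>s\<in>?I. of_bool (s \<in> gap_parts M))"
        by (simp add: sum_of_bool_eq Int_def)
      also have "\<dots> = (\<Sum>s\<in>?I. of_bool (2 \<le> s) * of_bool ({#s#} \<subseteq># M)
        - of_bool (\<not> t dvd s - 1) * of_bool ({#s, s - 1#} \<subseteq># M))"
      proof (rule sum.cong[OF refl])
        fix s assume s: "s \<in> ?I"
        have "s - 1 \<in># M - {#s#} \<longleftrightarrow> s - 1 \<in># M"
        proof -
          have "s - 1 \<noteq> s" using s by auto
          then show ?thesis by (simp add: in_diff_count)
        qed
        then have pair: "{#s, s - 1#} \<subseteq># M \<longleftrightarrow> s \<in># M \<and> s - 1 \<in># M"
          by (auto simp: insert_subset_eq_iff)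
        have "s - 1 \<in># M \<Longrightarrow> \<not> t dvd s - 1"
          using I[OF M, of "s - 1"] by auto
        moreover have "2 \<le> s" if "\<not> t dvd s - 1"
        proof (rule ccontr)
          assume "\<not> 2 \<le> s"
          then have "s - 1 = 0" by simp
          then show False using that by simp
        qed
        ultimately show "(of_bool (s \<in> gap_parts M) :: int) =
            of_bool (2 \<le> s) * of_bool ({#s#} \<subseteq># M)
            - of_bool (\<not> t dvd s - 1) * of_bool ({#s, s - 1#} \<subseteq># M)"
          unfolding pair by (auto simp: gap_parts_def)
      qed
      finally show ?thesis .
    qed
    then have "(\<Sum>M\<in>?P. int (card (gap_parts M))) =
        (\<Sum>s\<in>?I. \<Sum>M\<in>?P. of_bool (2 \<le> s) * of_bool ({#s#} \<subseteq># M)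
        - of_bool (\<not> t dvd s - 1) * of_bool ({#s, s - 1#} \<subseteq># M))"
      by (subst sum.swap) simp
    also have "\<dots> = (\<Sum>s\<in>?I. of_bool (2 \<le> s) * (fps_X ^ s * ?G) $ n
              - of_bool (\<not> t dvd s - 1) * (fps_X ^ (2 * s - 1) * ?G) $ n)"
    proof (rule sum.cong[OF refl])
      fix s assume s: "s \<in> ?I"
      have 1: "(\<Sum>M\<in>?P. of_bool ({#s#} \<subseteq># M)) = (fps_X ^ s * ?G) $ n"
        using containing[of "{#s#}"] s by simp
      have 2: "(\<Sum>M\<in>?P. of_bool ({#s, s - 1#} \<subseteq># M)) = (fps_X ^ (2 * s - 1) * ?G) $ n"
        if "\<not> t dvd s - 1"
      proof -
        have "s + (s - 1) = 2 * s - 1" using s by auto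
        then show ?thesis using containing[of "{#s, s - 1#}"] s that by simp
      qed
      show "(\<Sum>M\<in>?P. of_bool (2 \<le> s) * of_bool ({#s#} \<subseteq># M)
          - of_bool (\<not> t dvd s - 1) * of_bool ({#s, s - 1#} \<subseteq># M)) =
        of_bool (2 \<le> s) * (fps_X ^ s * ?G) $ n
              - of_bool (\<not> t dvd s - 1) * (fps_X ^ (2 * s - 1) * ?G) $ n"
        unfolding sum_subtractf sum_distrib_left[symmetric] 1 using 2
        by (cases "t dvd s - 1") auto
    qed
    finally show ?thesis .
  qed
  \<comment> \<open>The part of the factor that comes from \<open>s \<le> n\<close>; it has the same coefficients up to \<open>n\<close>.\<close>
  let ?Q = "\<Sum>s\<in>?I. fps_X ^ (2 * s) + (of_bool (2 \<le> s) * fps_X ^ s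
              - of_bool (\<not> t dvd s - 1) * fps_X ^ (2 * s - 1)) :: int fps"
  have "hook_count t 2 n =
      (\<Sum>\<mu>\<in>regular_partitions t n. card (gap_parts (mset \<mu>)) + card (repeated_parts (mset \<mu>)))"
    unfolding hook_count_def
    by (intro sum.cong refl card_2_hooks) (auto simp: regular_partitions_def is_partition_def)
  also have "\<dots> = (\<Sum>M\<in>?P. card (gap_parts M) + card (repeated_parts M))"
    by (rule sum.reindex_bij_betw[OF bij_betw_mset_regular_partitions])
  finally have "int (hook_count t 2 n) =
      (\<Sum>M\<in>?P. int (card (repeated_parts M))) + (\<Sum>M\<in>?P. int (card (gap_parts M)))"
    by (simp add: sum.distrib)
  also have "\<dots> = (\<Sum>s\<in>?I. ((fps_X ^ (2 * s) + (of_bool (2 \<le> s) * fps_X ^ s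
              - of_bool (\<not> t dvd s - 1) * fps_X ^ (2 * s - 1))) * ?G) $ n)"
    unfolding rep gap sum.distrib[symmetric]
    by (intro sum.cong refl) (auto simp: algebra_simps)
  also have "\<dots> = (?Q * ?G) $ n"
    by (simp add: sum_distrib_right fps_sum_nth)
  also have "fps_agree n (?Q * ?G) (two_hook_factor t * ?G)"
  proof (rule fps_agree_mult)
    show "fps_agree n ?Q (two_hook_factor t)"
      unfolding fps_agree_def
    proof (intro allI impI)
      fix m assume m: "m \<le> n"
      have "?Q $ m = (\<Sum>s\<in>?I. of_bool (m = 2 * s)) + (\<Sum>s\<in>?I. of_bool (2 \<le> s \<and> m = s))
          - (\<Sum>s\<in>?I. of_bool (\<not> t dvd s - 1 \<and> m = 2 * s - 1))"
        unfolding fps_sum_nth sum.distrib[symmetric] sum_subtractf[symmetric]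
        by (intro sum.cong refl) auto
      also have "(\<Sum>s\<in>?I. of_bool (m = 2 * s) :: int) =
          (\<Sum>s\<in>?I. if s = m div 2 then of_bool (even m) else 0)"
        by (intro sum.cong refl) auto
      also have "\<dots> = of_bool (even m \<and> \<not> t dvd m div 2)"
        using m by (auto simp: Suc_le_eq intro!: Nat.gr0I)
      also have "(\<Sum>s\<in>?I. of_bool (2 \<le> s \<and> m = s) :: int) =
          (\<Sum>s\<in>?I. if s = m then of_bool (2 \<le> m) else 0)"
        by (intro sum.cong refl) auto
      also have "\<dots> = of_bool (2 \<le> m \<and> \<not> t dvd m)"
        using m by auto
      also have "(\<Sum>s\<in>?I. of_bool (\<not> t dvd s - 1 \<and> m = 2 * s - 1) :: int) =
          (\<Sum>s\<in>?I. if s = m div 2 + 1 then of_bool (odd m \<and> \<not> t dvd m div 2) else 0)"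
        by (intro sum.cong refl) (auto elim!: oddE)
      also have "\<dots> = of_bool (odd m \<and> \<not> t dvd m div 2 \<and> \<not> t dvd m div 2 + 1)"
        using m by (auto elim!: oddE)
      finally show "?Q $ m = two_hook_factor t $ m" by (simp add: two_hook_factor_def)
    qed
  qed (simp add: fps_agree_def)
  then have "(?Q * ?G) $ n = (two_hook_factor t * ?G) $ n" by (simp add: fps_agree_def)
  finally show ?thesis .
qed

section \<open>The factors for 3- and 4-regular partitions\<close>

lemma two_hook_factor_periodic:
  assumes "2 \<le> m"
  shows "two_hook_factor t $ (m + 2 * t) = two_hook_factor t $ m"
proof -
  have half: "(m + 2 * t) div 2 = m div 2 + t" by simp
  have dvd: "t dvd k + t + 1 \<longleftrightarrow> t dvd k + 1" for k
    using dvd_add_left_iff[of t t "k + 1"] by (simp add: ac_simps)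
  show ?thesis
    unfolding two_hook_factor_def fps_nth_Abs_fps half dvd
    using assms by (simp add: dvd_add_left_iff)
qed

lemma two_hook_factor_mult_nth:
  "(two_hook_factor t * (1 - fps_X ^ (2 * t))) $ n =
     (if n < 2 * t + 2
      then two_hook_factor t $ n - (if n < 2 * t then 0 else two_hook_factor t $ (n - 2 * t))
      else 0)"
  using two_hook_factor_periodic[of "n - 2 * t" t]
  by (simp add: right_diff_distrib fps_X_power_mult_right_nth)

lemma fps_numeral_mult_nth: "(numeral k * F) $ n = numeral k * (F $ n :: 'a::comm_ring_1)"
  by (simp add: numeral_fps_const)

lemma two_hook_factor_3:
  "two_hook_factor 3 * (1 - fps_X ^ 6) =
     2 * fps_X ^ 2 - fps_X ^ 3 + 2 * fps_X ^ 4 + fps_X ^ 5 + fps_X ^ 7"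
proof (rule fps_ext)
  fix n :: nat
  let ?f = "\<lambda>m. two_hook_factor 3 $ m"
  have "(two_hook_factor 3 * (1 - fps_X ^ 6)) $ n =
      (if n < 8 then ?f n - (if n < 6 then 0 else ?f (n - 6)) else 0)"
    using two_hook_factor_mult_nth[of 3 n] by simp
  also have "\<dots> = (2 * fps_X ^ 2 - fps_X ^ 3 + 2 * fps_X ^ 4 + fps_X ^ 5 + fps_X ^ 7) $ n"
  proof (cases "n < 8")
    case True
    then consider "n = 0" | "n = 1" | "n = 2" | "n = 3" | "n = 4" | "n = 5" | "n = 6" | "n = 7"
      by (auto simp: numeral_eq_Suc less_Suc_eq)
    then show ?thesis
      by cases (simp_all add: two_hook_factor_def fps_numeral_mult_nth flip: numeral_2_eq_2)
  qed (simp add: fps_numeral_mult_nth)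
  finally show "(two_hook_factor 3 * (1 - fps_X ^ 6)) $ n =
      (2 * fps_X ^ 2 - fps_X ^ 3 + 2 * fps_X ^ 4 + fps_X ^ 5 + fps_X ^ 7) $ n" .
qed

lemma two_hook_factor_4:
  "two_hook_factor 4 * (1 - fps_X ^ 8) =
     2 * fps_X ^ 2 + fps_X ^ 4 + 2 * fps_X ^ 6 + fps_X ^ 7 + fps_X ^ 9"
proof (rule fps_ext)
  fix n :: nat
  let ?f = "\<lambda>m. two_hook_factor 4 $ m"
  have "(two_hook_factor 4 * (1 - fps_X ^ 8)) $ n =
      (if n < 10 then ?f n - (if n < 8 then 0 else ?f (n - 8)) else 0)"
    using two_hook_factor_mult_nth[of 4 n] by simp
  also have "\<dots> = (2 * fps_X ^ 2 + fps_X ^ 4 + 2 * fps_X ^ 6 + fps_X ^ 7 + fps_X ^ 9) $ n"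
  proof (cases "n < 10")
    case True
    then consider "n = 0" | "n = 1" | "n = 2" | "n = 3" | "n = 4" | "n = 5"
      | "n = 6" | "n = 7" | "n = 8" | "n = 9"
      by (auto simp: numeral_eq_Suc less_Suc_eq)
    then show ?thesis
      by cases (simp_all add: two_hook_factor_def fps_numeral_mult_nth flip: numeral_2_eq_2)
  qed (simp add: fps_numeral_mult_nth)
  finally show "(two_hook_factor 4 * (1 - fps_X ^ 8)) $ n =
      (2 * fps_X ^ 2 + fps_X ^ 4 + 2 * fps_X ^ 6 + fps_X ^ 7 + fps_X ^ 9) $ n" .
qed

text \<open>
  The partial sums of the coefficients of \<open>(A(4) - A(3)) (1 - X^24)\<close> are nonnegative except at 5
  and 8, where they are -1, and they are 1 from 21 on. The exceptions are compensated by the partial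
  sums 1 at 3 and 6: these four values together make up \<open>(1 - X^2) (X^3 + X^6)\<close>. The values at the
  other places below 21 are the coefficients of the factor of \<open>1 - X\<close> in the second summand.
\<close>

lemma two_hook_factor_diff:
  "(two_hook_factor 4 - two_hook_factor 3) * (1 - fps_X ^ 24) =
     (1 - fps_X ^ 1) * (1 - fps_X ^ 2) * (fps_X ^ 3 + fps_X ^ 6) +
     (1 - fps_X ^ 1) * (fps_X ^ 7 + fps_X ^ 9 + fps_X ^ 10 + fps_X ^ 12 + 2 * fps_X ^ 15 +
        2 * fps_X ^ 18 + fps_X ^ 19) + fps_X ^ 21"
proof -
  have "(two_hook_factor 4 - two_hook_factor 3) * (1 - fps_X ^ 24) =
     two_hook_factor 4 * (1 - fps_X ^ 8) * (1 + fps_X ^ 8 + fps_X ^ 16) -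
     two_hook_factor 3 * (1 - fps_X ^ 6) * (1 + fps_X ^ 6 + fps_X ^ 12 + fps_X ^ 18)"
    by (simp add: algebra_simps flip: power_add)
  also have "\<dots> = (1 - fps_X ^ 1) * (1 - fps_X ^ 2) * (fps_X ^ 3 + fps_X ^ 6) +
     (1 - fps_X ^ 1) * (fps_X ^ 7 + fps_X ^ 9 + fps_X ^ 10 + fps_X ^ 12 + 2 * fps_X ^ 15 +
        2 * fps_X ^ 18 + fps_X ^ 19) + fps_X ^ 21"
    unfolding two_hook_factor_3 two_hook_factor_4
    by (simp add: left_diff_distrib right_diff_distrib distrib_left distrib_right mult.assoc
          mult.left_commute[of _ 2] flip: power_add power_Suc)
       (simp add: algebra_simps)?
  finally show ?thesis .
qed

theorem theorem1p2:
  fixes n :: nat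
  shows "hook_count 4 2 n \<ge> hook_count 3 2 n"
proof -
  let ?A3 = "two_hook_factor 3" and ?A4 = "two_hook_factor 4"
  let ?S = "{s. \<not> (3::nat) dvd s}"
  let ?P3 = "partitions_gf ?S" and ?P4 = "partitions_gf {s. \<not> (4::nat) dvd s}"
  have no1: "?P3 * (1 - fps_X ^ 1) = partitions_gf (?S - {1})"
    using partitions_gf_remove[of ?S 1] by (simp add: mult.commute)
  have no12: "?P3 * ((1 - fps_X ^ 1) * (1 - fps_X ^ 2)) = partitions_gf (?S - {1} - {2})"
  proof -
    have "?P3 * ((1 - fps_X ^ 1) * (1 - fps_X ^ 2)) = (1 - fps_X ^ 2) * (?P3 * (1 - fps_X ^ 1))"
      by (simp only: mult_ac)
    also have "\<dots> = partitions_gf (?S - {1} - {2})"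
      unfolding no1 by (rule partitions_gf_remove) auto
    finally show ?thesis .
  qed
  have A4: "fps_nonneg ?A4"
  proof (rule fps_nonneg_cancel)
    show "fps_nonneg (?A4 * (1 - fps_X ^ 8))"
      unfolding two_hook_factor_4 by (intro fps_nonneg_intros)
  qed simp
  let ?U = "fps_X ^ 3 + fps_X ^ 6 :: int fps"
  let ?V = "fps_X ^ 7 + fps_X ^ 9 + fps_X ^ 10 + fps_X ^ 12 + 2 * fps_X ^ 15 +
      2 * fps_X ^ 18 + fps_X ^ 19 :: int fps"
  have "?P3 * (?A4 - ?A3) * (1 - fps_X ^ 24) =
      ?P3 * ((1 - fps_X ^ 1) * (1 - fps_X ^ 2)) * ?U + ?P3 * (1 - fps_X ^ 1) * ?V +
      ?P3 * fps_X ^ 21"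
    by (simp only: mult.assoc two_hook_factor_diff distrib_left)
  also have "\<dots> = partitions_gf (?S - {1} - {2}) * ?U + partitions_gf (?S - {1}) * ?V +
      ?P3 * fps_X ^ 21"
    by (simp only: no1 no12)
  also have "fps_nonneg \<dots>" by (intro fps_nonneg_intros)
  finally have "fps_nonneg (?P3 * (?A4 - ?A3) * (1 - fps_X ^ 24))" .
  then have "fps_nonneg (?P3 * (?A4 - ?A3))"
    by (rule fps_nonneg_cancel[rotated]) simp
  moreover have "fps_nonneg (?A4 * (?P4 - ?P3))"
    by (intro fps_nonneg_mult A4 fps_nonneg_partitions_gf_diff) simp_all
  ultimately have "fps_nonneg (?P3 * (?A4 - ?A3) + ?A4 * (?P4 - ?P3))"
    by (intro fps_nonneg_add)
  also have "?P3 * (?A4 - ?A3) + ?A4 * (?P4 - ?P3) = ?A4 * ?P4 - ?A3 * ?P3"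
    by (simp add: algebra_simps)
  finally have "0 \<le> (?A4 * ?P4) $ n - (?A3 * ?P3) $ n"
    by (simp add: fps_nonneg_def)
  then show ?thesis
    unfolding hook_count_2_eq[symmetric] by simp
qed

end
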